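(* Let $\bar{a}(N)$ denote the number of partitions $\lambda$ of $N$ with at least two parts, no parts of size $1$, and $\lambda_1=\lambda_2$. For every integer $j\ge 4$, $$PM(3j+2,j+1)-PM(3j,j)=\bar{a}(2j+2)-j.$$
   Context: A partition $\lambda=(\lambda_1\ge\cdots\ge\lambda_\ell)$ of $n$ is a finite nonincreasing sequence of positive integers with sum $n$; $\ell(\lambda)$ is its number of parts. The hook length $h_{(i,j)}(\lambda)$ of a cell $(i,j)$ of the Ferrers diagram is the number of cells consisting of the cell itself, the cells to its right in its row and the cells below it in its column. A numerical set is a subset $S\subseteq\mathbb{N}_0$ containing $0$ with finite complement; a numerical semigroup is a numerical set closed under addition. For a partition $\lambda$ let $S_\lambda=\mathbb{N}_0\setminus\{h_{(i,1)}(\lambda):1\le i\le\ell(\lambda)\}$. $PM(n,m)$ is the number of partitions $\lambda$ of $n$ having exactly $m-1$ parts equal to $1$ such that $S_\lambda$ is a numerical semigroup. *)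

theory Defs
  imports Main
begin

text \<open>A partition is the list of its parts in nonincreasing order; the list is
  0-indexed, whereas the rows and columns of the Ferrers diagram are 1-indexed.\<close>

definition partition_of :: "nat list \<Rightarrow> nat \<Rightarrow> bool" where
  "partition_of xs n \<longleftrightarrow> sorted_wrt (\<ge>) xs \<and> (\<forall>x\<in>set xs. 0 < x) \<and> sum_list xs = n"

definition ferrers :: "nat list \<Rightarrow> (nat \<times> nat) set" where
  "ferrers xs = {(i, j). 1 \<le> i \<and> i \<le> length xs \<and> 1 \<le> j \<and> j \<le> xs ! (i - 1)}"

definition hook :: "nat list \<Rightarrow> nat \<times> nat \<Rightarrow> (nat \<times> nat) set" where
  "hook xs = (\<lambda>(i, j). {(i', j') \<in> ferrers xs. (i' = i \<and> j \<le> j') \<or> (j' = j \<and> i \<le> i')})"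

definition hook_length :: "nat list \<Rightarrow> nat \<times> nat \<Rightarrow> nat" where
  "hook_length xs c = card (hook xs c)"

definition numerical_set :: "nat set \<Rightarrow> bool" where
  "numerical_set S \<longleftrightarrow> 0 \<in> S \<and> finite (- S)"

definition numerical_semigroup :: "nat set \<Rightarrow> bool" where
  "numerical_semigroup S \<longleftrightarrow> numerical_set S \<and> (\<forall>a\<in>S. \<forall>b\<in>S. a + b \<in> S)"

definition S_of :: "nat list \<Rightarrow> nat set" where
  "S_of xs = UNIV - {hook_length xs (i, 1) | i. 1 \<le> i \<and> i \<le> length xs}"

definition PM :: "nat \<Rightarrow> nat \<Rightarrow> nat" where
  "PM n m = card {xs. partition_of xs n \<and> count_list xs 1 + 1 = m \<and> numerical_semigroup (S_of xs)}"

definition a_bar :: "nat \<Rightarrow> nat" where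
  "a_bar N = card {xs. partition_of xs N \<and> 2 \<le> length xs \<and> 1 \<notin> set xs \<and> xs ! 0 = xs ! 1}"

text \<open>The sets counted above are finite, so \<^const>\<open>card\<close> is their number of elements.\<close>

lemma finite_partitions: "finite {xs. partition_of xs n}"
proof (rule finite_subset)
  have len: "length xs \<le> sum_list xs" if "\<forall>x\<in>set xs. 0 < x" for xs :: "nat list"
    using that by (induction xs) auto
  show "{xs. partition_of xs n} \<subseteq> {xs. set xs \<subseteq> {..n} \<and> length xs \<le> n}"
    using len by (auto simp: partition_of_def intro: member_le_sum_list)
  show "finite {xs. set xs \<subseteq> {..n} \<and> length xs \<le> n}"
    by (rule finite_lists_length_le) simp
qed

end

theory Submission
  imports Defs
begin

text \<open>Let \<open>m - 1\<close> be the number of ones of \<open>\<lambda>\<close>, so that \<open>m\<close> is the least nonzero element of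
  \<open>S\<^sub>\<lambda>\<close>. If \<open>\<lambda>\<close> has size at most \<open>3m\<close>, every gap except the largest one, \<open>h\<close>, is below \<open>2m\<close>, so
  \<open>S\<^sub>\<lambda>\<close> is a semigroup iff \<open>h\<close> is not a sum of two nonzero elements of \<open>S\<^sub>\<lambda>\<close>.
  Increasing \<open>\<lambda>\<^sub>1\<close> by one and appending a part \<open>1\<close> shifts the nonzero elements of \<open>S\<^sub>\<lambda>\<close> below \<open>h\<close>
  by \<open>1\<close> and \<open>h\<close> itself by \<open>2\<close>, hence preserves this condition; this map takes the partitions
  counted by \<open>PM(3j, j)\<close> bijectively to those counted by \<open>PM(3j+2, j+1)\<close> with \<open>\<lambda>\<^sub>1 > \<lambda>\<^sub>2\<close>.
  If \<open>\<lambda>\<^sub>1 = \<lambda>\<^sub>2\<close>, then \<open>h \<le> 2m\<close>, and the condition fails only for \<open>h = 2m\<close>, which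
  happens exactly for the \<open>j\<close> partitions \<open>(a, a, 2, \<dots>, 2, 1, \<dots>, 1)\<close> with \<open>2 \<le> a \<le> j + 1\<close>.\<close>

section \<open>First-column hook lengths as gaps\<close>

text \<open>These are the first-column hook lengths: the top row has \<open>x\<close> cells and
  \<open>length xs\<close> cells lie below its first one. Deleting the top row leaves the lower
  hooks unchanged, which makes the recursion possible.\<close>

fun gaps :: "nat list \<Rightarrow> nat set" where
  "gaps [] = {}"
| "gaps (x # xs) = insert (x + length xs) (gaps xs)"

lemma gaps_conv_nth: "gaps xs = {xs ! i + length xs - Suc i | i. i < length xs}"
proof (induction xs)
  case (Cons x xs)
  have "{(x # xs) ! i + length (x # xs) - Suc i | i. i < length (x # xs)}
      = insert (x + length xs) {xs ! i + length xs - Suc i | i. i < length xs}"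
    (is "?L = ?R")
  proof (intro set_eqI iffI)
    fix g assume "g \<in> ?L"
    then obtain i where "i < Suc (length xs)" "g = (x # xs) ! i + length (x # xs) - Suc i" by auto
    then show "g \<in> ?R" by (cases i) auto
  next
    fix g assume "g \<in> ?R"
    then consider "g = x + length xs" | i where "i < length xs" "g = xs ! i + length xs - Suc i"
      by auto
    then show "g \<in> ?L"
    proof cases
      case 1
      then show ?thesis by (intro CollectI exI[of _ 0]) simp
    next
      case 2
      then show ?thesis by (intro CollectI exI[of _ "Suc i"]) simp
    qed
  qed
  with Cons show ?case by simp
qed simp

lemma hook_length_first_column:
  assumes "\<forall>x\<in>set xs. 0 < x" "1 \<le> i" "i \<le> length xs"
  shows "hook_length xs (i, 1) = xs ! (i - 1) + length xs - i"
proof -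
  have pos: "0 < xs ! (k - 1)" if "1 \<le> k" "k \<le> length xs" for k
    using that assms(1) by simp
  \<comment> \<open>Since all parts are positive, every lower row reaches column 1, so the leg has
    exactly \<open>length xs - i\<close> cells.\<close>
  have "hook xs (i, 1) = Pair i ` {1..xs ! (i - 1)} \<union> (\<lambda>k. (k, 1)) ` {Suc i..length xs}"
    (is "_ = ?H")
  proof (intro set_eqI iffI)
    fix c assume "c \<in> hook xs (i, 1)"
    then show "c \<in> ?H"
      by (cases "fst c = i") (auto simp: hook_def ferrers_def image_iff)
  next
    fix c assume "c \<in> ?H"
    then show "c \<in> hook xs (i, 1)"
      using assms(2,3) pos by (auto simp: hook_def ferrers_def Suc_le_eq)
  qed
  moreover have "card (Pair i ` {1..xs ! (i - 1)} \<union> (\<lambda>k. (k, 1::nat)) ` {Suc i..length xs})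
      = xs ! (i - 1) + (length xs - i)"
    by (subst card_Un_disjoint) (auto simp: card_image inj_on_def)
  ultimately show ?thesis
    using assms(3) by (simp add: hook_length_def)
qed

lemma S_of_eq_gaps:
  assumes "\<forall>x\<in>set xs. 0 < x"
  shows "S_of xs = UNIV - gaps xs"
proof -
  have "{hook_length xs (i, 1) | i. 1 \<le> i \<and> i \<le> length xs} = gaps xs"
  proof (intro set_eqI iffI)
    fix g assume "g \<in> {hook_length xs (i, 1) | i. 1 \<le> i \<and> i \<le> length xs}"
    then obtain i where "1 \<le> i" "i \<le> length xs" "g = hook_length xs (i, 1)" by blast
    then have "g = xs ! (i - 1) + length xs - Suc (i - 1)" "i - 1 < length xs"
      using hook_length_first_column[OF assms] by auto
    then show "g \<in> gaps xs" unfolding gaps_conv_nth by blast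
  next
    fix g assume "g \<in> gaps xs"
    then obtain i where "i < length xs" "g = xs ! i + length xs - Suc i"
      unfolding gaps_conv_nth by blast
    then have "g = hook_length xs (Suc i, 1)" "1 \<le> Suc i" "Suc i \<le> length xs"
      using hook_length_first_column[OF assms, of "Suc i"] by auto
    then show "g \<in> {hook_length xs (i, 1) | i. 1 \<le> i \<and> i \<le> length xs}" by blast
  qed
  then show ?thesis by (simp add: S_of_def)
qed

lemma finite_gaps: "finite (gaps xs)"
  by (induction xs) auto

lemma zero_notin_gaps: "\<forall>x\<in>set xs. 0 < x \<Longrightarrow> 0 \<notin> gaps xs"
  by (induction xs) auto

text \<open>The new bottom row lengthens every first-column hook by one cell and has hook length 1
  itself.\<close>

lemma gaps_snoc_one: "gaps (xs @ [1]) = insert 1 (Suc ` gaps xs)"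
  by (induction xs) auto

lemma gaps_le_head:
  assumes "sorted_wrt (\<ge>) (x # xs)" "g \<in> gaps (x # xs)"
  shows "g \<le> x + length xs"
  using assms
proof (induction xs arbitrary: x)
  case (Cons y ys)
  then show ?case using Cons.IH[of y] by fastforce
qed simp

section \<open>Trailing ones and the semigroup criterion\<close>

lemma split_trailing_ones:
  assumes "sorted_wrt (\<ge>) xs" "\<forall>x\<in>set xs. (0::nat) < x"
  obtains us where "xs = us @ replicate (count_list xs 1) 1" "\<forall>u\<in>set us. 2 \<le> u"
proof -
  have "\<exists>us. xs = us @ replicate (count_list xs 1) 1 \<and> (\<forall>u\<in>set us. 2 \<le> u)"
    using assms
  proof (induction xs)
    case (Cons x xs)
    then obtain us where us: "xs = us @ replicate (count_list xs 1) 1" "\<forall>u\<in>set us. 2 \<le> u"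
      by auto
    show ?case
    proof (cases "x = 1")
      case True
      have "us = []"
      proof (rule ccontr)
        assume "us \<noteq> []"
        then obtain u where "u \<in> set us" by (cases us) auto
        moreover have "u \<in> set xs" using \<open>u \<in> set us\<close> us(1) by (metis UnI1 set_append)
        ultimately show False using us(2) Cons.prems(1) True by fastforce
      qed
      then show ?thesis using us True by (intro exI[of _ "[]"]) simp
    next
      case False
      moreover have "2 \<le> x" using False Cons.prems(2) by (cases x) auto
      ultimately show ?thesis using us by (intro exI[of _ "x # us"]) simp
    qed
  qed simp
  then show ?thesis using that by blast
qed

text \<open>The ones have hook lengths 1 to \<open>k\<close>. Any row above them has at least 2
  cells and at least \<open>k\<close> rows below it, so its hook length is at least
  \<open>k + 2\<close> and \<open>Suc k\<close> is skipped.\<close>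

lemma gaps_append_ones:
  assumes "\<forall>u\<in>set us. 2 \<le> u"
  shows "{1..k} \<subseteq> gaps (us @ replicate k 1)" "Suc k \<notin> gaps (us @ replicate k 1)"
proof -
  have rep: "gaps (replicate k 1) = {1..k}"
    by (induction k) (auto simp: atLeastAtMostSuc_conv)
  show "{1..k} \<subseteq> gaps (us @ replicate k 1)"
    by (induction us) (use rep in auto)
  show "Suc k \<notin> gaps (us @ replicate k 1)"
    using assms by (induction us) (use rep in auto)
qed

lemma gaps_count_ones:
  assumes "sorted_wrt (\<ge>) xs" "\<forall>x\<in>set xs. (0::nat) < x"
  shows "{1..count_list xs 1} \<subseteq> gaps xs" "Suc (count_list xs 1) \<notin> gaps xs"
  using split_trailing_ones[OF assms] gaps_append_ones by metis+

text \<open>Nonzero elements of the set are at least \<open>m\<close>, so a sum of two of them is at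
  least \<open>2 * m\<close> and can only hit the gap \<open>h\<close>. Asking \<open>a\<close> and
  \<open>b\<close> to avoid \<open>T\<close> alone suffices: if positive \<open>a\<close> and
  \<open>b\<close> sum to \<open>h\<close>, neither equals \<open>h\<close>.\<close>

lemma semigroup_iff_largest_gap:
  assumes "finite T" "T \<subseteq> {1..<2 * m}" "{1..<m} \<subseteq> T" "0 < h"
  shows "numerical_semigroup (UNIV - insert h T) \<longleftrightarrow>
    (\<forall>a b. 0 < a \<longrightarrow> 0 < b \<longrightarrow> a \<notin> T \<longrightarrow> b \<notin> T \<longrightarrow> a + b \<noteq> h)" (is "?L \<longleftrightarrow> ?R")
proof
  assume ?L
  then have cl: "a + b \<noteq> h" if "a \<notin> insert h T" "b \<notin> insert h T" for a b
    using that by (auto simp: numerical_semigroup_def)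
  show ?R
  proof (intro allI impI notI)
    fix a b assume "0 < a" "0 < b" "a \<notin> T" "b \<notin> T" "a + b = h"
    with cl[of a b] show False by auto
  qed
next
  assume R: ?R
  have "a + b \<notin> insert h T" if ab: "a \<notin> insert h T" "b \<notin> insert h T" for a b
  proof (cases "a = 0 \<or> b = 0")
    case False
    then have "m \<le> a" "m \<le> b"
      using ab assms(3) by (auto simp: subset_iff Suc_le_eq not_less[symmetric])
    then have "a + b \<notin> T" using assms(2) by fastforce
    then show ?thesis using R ab False by auto
  qed (use ab in auto)
  moreover have "- (UNIV - insert h T) = insert h T" by auto
  ultimately show ?L
    using assms by (auto simp: numerical_semigroup_def numerical_set_def)
qed

lemma two_length_le_sum_plus_ones:
  "\<forall>x\<in>set xs. (0::nat) < x \<Longrightarrow> 2 * length xs \<le> sum_list xs + count_list xs 1"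
  by (induction xs) auto

lemma gaps_tail_bound:
  assumes "partition_of (x # t) n" "n \<le> 3 * m" "count_list t 1 < m"
  shows "gaps t \<subseteq> {1..<2 * m}"
proof (cases t)
  case (Cons y s)
  have srt: "sorted_wrt (\<ge>) (y # s)" and pos: "\<forall>z\<in>set t. 0 < z" and "y \<le> x"
    and "x + y + sum_list s = n"
    using assms(1) Cons by (auto simp: partition_of_def)
  moreover have "2 * length s \<le> sum_list s + count_list s 1"
    using pos Cons by (intro two_length_le_sum_plus_ones) auto
  moreover have "count_list s 1 \<le> count_list t 1" using Cons by simp
  \<comment> \<open>Doubling the largest gap of \<open>t\<close> gives 2y + 2 length s \<le> x + y +
    sum s + (ones of s) \<le> 3m + (m - 1) < 4m.\<close>
  ultimately have "y + length s < 2 * m" using assms(2,3) by linarith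
  then have "g < 2 * m" if "g \<in> gaps t" for g
    using gaps_le_head[OF srt] that Cons by fastforce
  moreover have "0 \<notin> gaps t" using zero_notin_gaps[OF pos] .
  ultimately show ?thesis by (metis One_nat_def Suc_leI atLeastLessThan_iff gr0I subsetI)
qed simp

text \<open>The right-hand side does not mention \<open>m\<close>, so the criterion can be compared
  across different numbers of ones.\<close>

lemma semigroup_partition_iff:
  assumes "partition_of (x # t) n" "n \<le> 3 * m" "count_list t 1 + 1 = m"
  shows "numerical_semigroup (S_of (x # t)) \<longleftrightarrow>
    (\<forall>a b. 0 < a \<longrightarrow> 0 < b \<longrightarrow> a \<notin> gaps t \<longrightarrow> b \<notin> gaps t \<longrightarrow> a + b \<noteq> x + length t)"
proof -
  have pos: "\<forall>z\<in>set (x # t). 0 < z" and srt: "sorted_wrt (\<ge>) t"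
    using assms(1) by (auto simp: partition_of_def)
  have "gaps t \<subseteq> {1..<2 * m}" using gaps_tail_bound[OF assms(1,2)] assms(3) by simp
  moreover have "{1..<m} \<subseteq> gaps t"
    using gaps_count_ones(1)[OF srt] pos assms(3) by auto
  ultimately show ?thesis
    using S_of_eq_gaps[OF pos] semigroup_iff_largest_gap[of "gaps t" m "x + length t"]
      finite_gaps pos by simp
qed

section \<open>Partitions with unequal first parts\<close>

definition semigroup_partitions :: "nat \<Rightarrow> nat \<Rightarrow> nat list set" where
  "semigroup_partitions n m =
    {xs. partition_of xs n \<and> count_list xs 1 + 1 = m \<and> numerical_semigroup (S_of xs)}"

definition equal_head_partitions :: "nat \<Rightarrow> nat list set" where
  "equal_head_partitions N =
    {xs. partition_of xs N \<and> 2 \<le> length xs \<and> 1 \<notin> set xs \<and> xs ! 0 = xs ! 1}"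

lemma PM_eq_card: "PM n m = card (semigroup_partitions n m)"
  by (simp add: PM_def semigroup_partitions_def)

lemma finite_semigroup_partitions: "finite (semigroup_partitions n m)"
  by (rule finite_subset[OF _ finite_partitions[of n]]) (auto simp: semigroup_partitions_def)

lemma finite_equal_head_partitions: "finite (equal_head_partitions n)"
  by (rule finite_subset[OF _ finite_partitions[of n]]) (auto simp: equal_head_partitions_def)

text \<open>The criterion applies on both sides because 3j + 2 \<le> 3(j + 1). The bound
  \<open>2 \<le> x\<close> keeps the head from counting as a one, and \<open>y \<le> x\<close> keeps
  the list sorted when the head is decreased back.\<close>

lemma grow_in_semigroup_partitions_iff:
  assumes "2 \<le> x" "\<forall>y\<in>set t. y \<le> x"
  shows "Suc x # t @ [1] \<in> semigroup_partitions (3 * j + 2) (j + 1)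
    \<longleftrightarrow> x # t \<in> semigroup_partitions (3 * j) j" (is "?L \<longleftrightarrow> ?R")
proof -
  have part: "partition_of (Suc x # t @ [1]) (3 * j + 2) \<longleftrightarrow> partition_of (x # t) (3 * j)"
    using assms by (auto simp: partition_of_def sorted_wrt_append Suc_le_eq le_Suc_eq)
  have cnt: "count_list (Suc x # t @ [1]) 1 + 1 = j + 1 \<longleftrightarrow> count_list (x # t) 1 + 1 = j"
    using assms(1) by auto
  have "numerical_semigroup (S_of (Suc x # t @ [1])) \<longleftrightarrow> numerical_semigroup (S_of (x # t))"
    if p: "partition_of (x # t) (3 * j)" and c: "count_list (x # t) 1 + 1 = j"
  proof -
    have c': "count_list t 1 + 1 = j" using c assms(1) by auto
    have "numerical_semigroup (S_of (Suc x # t @ [1])) \<longleftrightarrow>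
      (\<forall>a b. 0 < a \<longrightarrow> 0 < b \<longrightarrow> a \<notin> gaps (t @ [1]) \<longrightarrow> b \<notin> gaps (t @ [1])
        \<longrightarrow> a + b \<noteq> Suc x + length (t @ [1]))"
      using p part c' by (intro semigroup_partition_iff[where n = "3 * j + 2" and m = "j + 1"]) auto
    also have "\<dots> \<longleftrightarrow> (\<forall>a b. 0 < a \<longrightarrow> 0 < b \<longrightarrow> a \<notin> gaps t \<longrightarrow> b \<notin> gaps t \<longrightarrow> a + b \<noteq> x + length t)"
      (is "?P \<longleftrightarrow> ?Q")
    proof
      assume P: ?P
      show ?Q
      proof (intro allI impI)
        fix a b assume "0 < a" "0 < b" "a \<notin> gaps t" "b \<notin> gaps t"
        then show "a + b \<noteq> x + length t"
          using P[rule_format, of "Suc a" "Suc b"] unfolding gaps_snoc_one by auto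
      qed
    next
      assume Q: ?Q
      show ?P
      proof (intro allI impI)
        fix a b assume *: "0 < a" "0 < b" "a \<notin> gaps (t @ [1])" "b \<notin> gaps (t @ [1])"
        \<comment> \<open>The gap 1 of \<open>t @ [1]\<close> rules out \<open>a = 1\<close> and
          \<open>b = 1\<close>, so \<open>a'\<close> and \<open>b'\<close> are positive.\<close>
        then obtain a' b' where "a = Suc a'" "b = Suc b'" by (metis gr0_implies_Suc)
        with * show "a + b \<noteq> Suc x + length (t @ [1])"
          using Q[rule_format, of a' b'] unfolding gaps_snoc_one by auto
      qed
    qed
    also have "\<dots> \<longleftrightarrow> numerical_semigroup (S_of (x # t))"
      using semigroup_partition_iff[OF p _ c'] by simp
    finally show ?thesis .
  qed
  with part cnt show ?thesis
    unfolding semigroup_partitions_def mem_Collect_eq by metis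
qed

lemma sum_list_all_ones: "\<forall>x\<in>set xs. x = (1::nat) \<Longrightarrow> sum_list xs = count_list xs 1"
  by (induction xs) auto

lemma card_unequal_head:
  assumes "2 \<le> j"
  shows "card {xs \<in> semigroup_partitions (3 * j + 2) (j + 1). xs ! 0 \<noteq> xs ! 1}
    = card (semigroup_partitions (3 * j) j)"
proof -
  let ?A = "semigroup_partitions (3 * j) j"
  let ?B = "{xs \<in> semigroup_partitions (3 * j + 2) (j + 1). xs ! 0 \<noteq> xs ! 1}"
  let ?f = "\<lambda>xs. Suc (hd xs) # tl xs @ [1]"
  have A: "\<exists>x t. xs = x # t \<and> 2 \<le> x \<and> t \<noteq> [] \<and> (\<forall>y\<in>set t. y \<le> x)" if "xs \<in> ?A" for xs
  proof -
    have p: "partition_of xs (3 * j)" and c: "count_list xs 1 + 1 = j"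
      using that by (auto simp: semigroup_partitions_def)
    obtain x t where xs: "xs = x # t"
      using p assms by (cases xs) (auto simp: partition_of_def)
    have le: "\<forall>y\<in>set t. y \<le> x" and "0 < x" and pos: "\<forall>y\<in>set t. 0 < y"
      using p xs by (auto simp: partition_of_def)
    have "2 \<le> x"
    proof (rule ccontr)
      assume "\<not> 2 \<le> x"
      \<comment> \<open>With all parts equal to 1, the sum 3j would equal the number of ones, j -
        1.\<close>
      then have "\<forall>y\<in>set xs. y = 1" using le pos \<open>0 < x\<close> xs by fastforce
      then show False using sum_list_all_ones[of xs] p c by (auto simp: partition_of_def)
    qed
    moreover have "t \<noteq> []" using c xs \<open>2 \<le> x\<close> assms by auto
    ultimately show ?thesis using xs le by blast
  qed
  have "bij_betw ?f ?A ?B"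
  proof (rule bij_betwI')
    fix xs ys assume "xs \<in> ?A" "ys \<in> ?A"
    then have "xs \<noteq> []" "ys \<noteq> []" using A by blast+
    then show "(?f xs = ?f ys) = (xs = ys)" by (cases xs; cases ys) auto
  next
    fix xs assume xs: "xs \<in> ?A"
    then obtain x t where x: "xs = x # t" "2 \<le> x" "t \<noteq> []" "\<forall>y\<in>set t. y \<le> x" using A by blast
    then have "t ! 0 \<le> x" by simp
    then have "Suc x \<noteq> t ! 0" by simp
    with x xs show "?f xs \<in> ?B"
      using grow_in_semigroup_partitions_iff[of x t j] by (auto simp: nth_append)
  next
    fix xs assume xs: "xs \<in> ?B"
    then have p: "partition_of xs (3 * j + 2)" and c: "count_list xs 1 = j" and ne: "xs ! 0 \<noteq> xs ! 1"
      by (auto simp: semigroup_partitions_def)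
    obtain us where us: "xs = us @ replicate j 1" "\<forall>u\<in>set us. 2 \<le> u"
      using split_trailing_ones[of xs] p c by (auto simp: partition_of_def)
    have "us \<noteq> []" using us p by (auto simp: partition_of_def sum_list_replicate)
    then obtain y vs where y: "us = y # vs" by (cases us) auto
    define t where "t = vs @ replicate (j - 1) 1"
    have "replicate j (1::nat) = replicate (j - 1) 1 @ [1]"
      using assms by (cases j) (auto simp: replicate_append_same)
    then have xs_eq: "xs = y # t @ [1]" using us y t_def by simp
    \<comment> \<open>As j \<ge> 2, a one remains in \<open>t\<close> after the last one is removed;
      thus \<open>xs ! 1\<close> is \<open>t ! 0\<close>, and the strict inequality of the first two
      parts passes to \<open>y\<close> and \<open>t\<close>.\<close>
    have "t \<noteq> []" using assms t_def by auto
    then have "y \<noteq> t ! 0" using ne xs_eq by (simp add: nth_append)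
    moreover have "t ! 0 \<le> y" "\<forall>z\<in>set t. z \<le> t ! 0" "\<forall>z\<in>set t. 0 < z"
      using p xs_eq \<open>t \<noteq> []\<close> by (cases t; auto simp: partition_of_def)+
    ultimately have lt: "\<forall>z\<in>set t. z < y" and pos: "\<forall>z\<in>set t. 0 < z" by fastforce+
    \<comment> \<open>The decreased head must not become a one. If \<open>y\<close> were 2, all
      other parts would be ones, and the sum would be 2 + j instead of 3j + 2.\<close>
    have "3 \<le> y"
    proof (rule ccontr)
      assume "\<not> 3 \<le> y"
      then have "\<forall>z\<in>set (t @ [1]). z = 1" and "y = 2" using lt pos us y by fastforce+
      then show False using sum_list_all_ones[of "t @ [1]"] p c xs_eq assms
        by (auto simp: partition_of_def)
    qed
    then obtain x where x: "y = Suc x" "2 \<le> x" by (cases y) auto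
    have "x # t \<in> ?A"
      using grow_in_semigroup_partitions_iff[of x t j] x lt xs xs_eq by (auto simp: less_Suc_eq_le)
    then show "\<exists>zs\<in>?A. xs = ?f zs" using xs_eq x by force
  qed
  then show ?thesis by (rule bij_betw_same_card[symmetric])
qed

section \<open>Partitions with equal first parts\<close>

lemma sorted_wrt_ge_replicate: "sorted_wrt (\<ge>) (replicate k (x::'a::preorder))"
  by (induction k) auto

lemma partition_of_append_ones_iff:
  assumes "\<forall>u\<in>set us. 2 \<le> u"
  shows "partition_of (us @ replicate k 1) (n + k) \<longleftrightarrow> partition_of us n"
  using assms by (auto simp: partition_of_def sorted_wrt_append sum_list_replicate
    sorted_wrt_ge_replicate)

lemma count_list_append_ones:
  assumes "\<forall>u\<in>set us. (2::nat) \<le> u"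
  shows "count_list (us @ replicate k 1) 1 = k"
proof -
  have "count_list us 1 = 0" using assms by (auto simp: count_list_0_iff)
  moreover have "count_list (replicate k (1::nat)) 1 = k" by (induction k) auto
  ultimately show ?thesis by simp
qed

text \<open>Two nonzero non-gaps of the tail sum to at least 2(j + 1), with equality attained by j +
  1 twice. The head hook is at most 2(j + 1), so only equality is forbidden; written in terms of
  \<open>us\<close>, the head hook is \<open>us ! 0 + length us - 1 + j\<close>.\<close>

lemma append_ones_semigroup_iff:
  assumes "us \<in> equal_head_partitions (2 * j + 2)"
  shows "numerical_semigroup (S_of (us @ replicate j 1)) \<longleftrightarrow> us ! 0 + length us \<noteq> j + 3"
proof -
  have p: "partition_of us (2 * j + 2)" and one: "1 \<notin> set us"
    and len: "2 \<le> length us" and eq: "us ! 0 = us ! 1"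
    using assms by (auto simp: equal_head_partitions_def)
  have two: "\<forall>u\<in>set us. 2 \<le> u"
  proof
    fix u assume "u \<in> set us"
    then have "u \<noteq> 1" "0 < u" using one p by (auto simp: partition_of_def)
    then show "2 \<le> u" by simp
  qed
  obtain x vs where us: "us = x # x # vs"
    using len eq by (cases us; cases "tl us") auto
  define t where "t = x # vs @ replicate j 1"
  have xt: "us @ replicate j 1 = x # t" using us t_def by simp
  have pt: "partition_of (x # t) (3 * j + 2)"
    using partition_of_append_ones_iff[OF two, of j "2 * j + 2"] p xt by simp
  have ct: "count_list t 1 + 1 = j + 1"
    using count_list_append_ones[of "x # vs" j] two us t_def by simp
  have sg: "numerical_semigroup (S_of (x # t)) \<longleftrightarrow>
    (\<forall>a b. 0 < a \<longrightarrow> 0 < b \<longrightarrow> a \<notin> gaps t \<longrightarrow> b \<notin> gaps t \<longrightarrow> a + b \<noteq> x + length t)"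
    by (rule semigroup_partition_iff[OF pt _ ct]) simp
  have "gaps t \<subseteq> {1..<2 * (j + 1)}" by (rule gaps_tail_bound[OF pt]) (use ct in auto)
  \<comment> \<open>This is the hook of the second row, one less than that of the first because the
    two parts are equal.\<close>
  moreover have "x + length vs + j \<in> gaps t" by (simp add: t_def)
  ultimately have h: "x + length t \<le> 2 * (j + 1)" by (auto simp: t_def)
  have lo: "{1..j} \<subseteq> gaps t" and hi: "Suc j \<notin> gaps t"
    using gaps_append_ones[of "x # vs" j] two us t_def by auto
  have "numerical_semigroup (S_of (x # t)) \<longleftrightarrow> x + length t \<noteq> 2 * (j + 1)"
  proof
    assume "numerical_semigroup (S_of (x # t))"
    then show "x + length t \<noteq> 2 * (j + 1)" using sg hi by fastforce
  next
    assume ne: "x + length t \<noteq> 2 * (j + 1)"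
    show "numerical_semigroup (S_of (x # t))" unfolding sg
    proof (intro allI impI)
      fix a b assume "0 < a" "0 < b" "a \<notin> gaps t" "b \<notin> gaps t"
      then have "\<not> a \<le> j" "\<not> b \<le> j" using lo by (force simp: subset_iff Suc_le_eq)+
      then show "a + b \<noteq> x + length t" using h ne by simp
    qed
  qed
  then show ?thesis using xt us t_def by auto
qed

lemma all_two_if_sum_le:
  "\<lbrakk>\<forall>u\<in>set us. (2::nat) \<le> u; sum_list us \<le> 2 * length us\<rbrakk> \<Longrightarrow> us = replicate (length us) 2"
proof (induction us)
  case (Cons u us)
  have "2 * length us \<le> sum_list us"
    using Cons.prems(1) sum_list_mono[of us "\<lambda>_. 2" "\<lambda>u. u"] by (simp add: sum_list_triv)
  with Cons show ?case by auto
qed simp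

text \<open>For \<open>us = x # x # vs\<close> the two conditions give x + length vs = j + 1 and 2x
  + sum vs = 2j + 2, so \<open>vs\<close> has average 2. As its parts are at least 2, it consists of
  twos, and \<open>x\<close> alone determines \<open>us\<close>.\<close>

lemma card_exceptional_equal_head:
  "card {us \<in> equal_head_partitions (2 * j + 2). us ! 0 + length us = j + 3} = j"
proof -
  let ?D = "{us \<in> equal_head_partitions (2 * j + 2). us ! 0 + length us = j + 3}"
  let ?g = "\<lambda>a. a # a # replicate (j + 1 - a) (2::nat)"
  have "bij_betw ?g {2..j + 1} ?D"
  proof (rule bij_betwI')
    fix a assume "a \<in> {2..j + 1}"
    then show "?g a \<in> ?D"
      by (auto simp: equal_head_partitions_def partition_of_def sum_list_replicate sorted_wrt_ge_replicate)
  next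
    fix us assume us: "us \<in> ?D"
    then obtain x vs where x: "us = x # x # vs"
      by (cases us; cases "tl us") (auto simp: equal_head_partitions_def)
    have "\<forall>u\<in>set us. 0 < u" "1 \<notin> set us"
      using us by (auto simp: equal_head_partitions_def partition_of_def)
    then have two: "\<forall>u\<in>set us. 2 \<le> u" by (metis One_nat_def Suc_1 Suc_leI le_neq_implies_less)
    have sum: "2 * x + sum_list vs = 2 * j + 2" and l: "x + length vs = j + 1"
      using us x by (auto simp: equal_head_partitions_def partition_of_def)
    then have "vs = replicate (length vs) 2"
      by (intro all_two_if_sum_le) (use two x in auto)
    moreover have "length vs = j + 1 - x" using l by simp
    ultimately have "us = ?g x" using x by simp
    moreover have "x \<in> {2..j + 1}" using two x l by auto
    ultimately show "\<exists>a\<in>{2..j + 1}. us = ?g a" by blast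
  qed auto
  then show ?thesis using bij_betw_same_card by fastforce
qed

text \<open>Stripping the \<open>j\<close> ones leaves a partition of 2j + 2 without ones; the
  exceptional ones are removed from the count.\<close>

lemma card_equal_head:
  assumes "2 \<le> j"
  shows "card {xs \<in> semigroup_partitions (3 * j + 2) (j + 1). xs ! 0 = xs ! 1} + j
    = card (equal_head_partitions (2 * j + 2))"
proof -
  let ?B = "{xs \<in> semigroup_partitions (3 * j + 2) (j + 1). xs ! 0 = xs ! 1}"
  let ?R = "equal_head_partitions (2 * j + 2)"
  let ?D = "{us \<in> ?R. us ! 0 + length us = j + 3}"
  let ?g = "\<lambda>us. us @ replicate j (1::nat)"
  have two: "2 \<le> u" if "us \<in> ?R" "u \<in> set us" for us u
  proof -
    have "u \<noteq> 1" "0 < u" using that by (auto simp: equal_head_partitions_def partition_of_def)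
    then show ?thesis by simp
  qed
  have "bij_betw ?g (?R - ?D) ?B"
  proof (rule bij_betwI')
    fix us assume us: "us \<in> ?R - ?D"
    then have two': "\<forall>u\<in>set us. 2 \<le> u" using two by blast
    have "partition_of us (2 * j + 2)" using us by (simp add: equal_head_partitions_def)
    then have "partition_of (?g us) (3 * j + 2)"
      using partition_of_append_ones_iff[OF two', of j "2 * j + 2"] by simp
    moreover have "count_list (?g us) 1 = j" by (rule count_list_append_ones[OF two'])
    moreover have "numerical_semigroup (S_of (?g us))"
      using append_ones_semigroup_iff[of us j] us by auto
    moreover have "?g us ! 0 = ?g us ! 1"
      using us by (auto simp: equal_head_partitions_def nth_append)
    ultimately show "?g us \<in> ?B" by (simp add: semigroup_partitions_def)
  next
    fix xs assume xs: "xs \<in> ?B"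
    then have p: "partition_of xs (3 * j + 2)" and c: "count_list xs 1 = j" and eq: "xs ! 0 = xs ! 1"
      and sg: "numerical_semigroup (S_of xs)"
      by (auto simp: semigroup_partitions_def)
    obtain us where us: "xs = ?g us" "\<forall>u\<in>set us. 2 \<le> u"
      using split_trailing_ones[of xs] p c by (auto simp: partition_of_def)
    have pu: "partition_of us (2 * j + 2)"
      using partition_of_append_ones_iff[OF us(2), of j "2 * j + 2"] p us by simp
    then obtain y vs where y: "us = y # vs" by (cases us) (auto simp: partition_of_def)
    \<comment> \<open>Otherwise \<open>xs ! 1\<close> would be one of the appended ones, while
      \<open>y\<close> is at least 2.\<close>
    have "vs \<noteq> []" using eq us y assms by auto
    then have "us \<in> ?R"
      using pu us y eq by (cases vs) (auto simp: equal_head_partitions_def)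
    moreover have "us \<notin> ?D" using append_ones_semigroup_iff[of us j] sg us by auto
    ultimately show "\<exists>us\<in>?R - ?D. xs = ?g us" using us by blast
  qed auto
  then have "card ?B = card (?R - ?D)" by (rule bij_betw_same_card[symmetric])
  moreover have "card (?R - ?D) + card ?D = card ?R"
    using card_Diff_subset[of ?D ?R] card_mono[of ?R ?D] finite_equal_head_partitions[of "2 * j + 2"]
    by simp
  ultimately show ?thesis using card_exceptional_equal_head[of j] by simp
qed

theorem theorem5p7:
  fixes j :: nat
  assumes "j \<ge> 4"
  shows "int (PM (3 * j + 2) (j + 1)) - int (PM (3 * j) j) = int (a_bar (2 * j + 2)) - int j"
proof -
  let ?B = "semigroup_partitions (3 * j + 2) (j + 1)"
  \<comment> \<open>Lists in \<open>?B\<close> contain \<open>j\<close> ones with j \<ge> 4, so both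
    indices refer to actual parts.\<close>
  have "?B = {xs \<in> ?B. xs ! 0 \<noteq> xs ! 1} \<union> {xs \<in> ?B. xs ! 0 = xs ! 1}" by blast
  then have "card ?B = card {xs \<in> ?B. xs ! 0 \<noteq> xs ! 1} + card {xs \<in> ?B. xs ! 0 = xs ! 1}"
    using card_Un_disjoint[of "{xs \<in> ?B. xs ! 0 \<noteq> xs ! 1}" "{xs \<in> ?B. xs ! 0 = xs ! 1}"]
      finite_semigroup_partitions[of "3 * j + 2" "j + 1"] by auto
  moreover have "a_bar (2 * j + 2) = card (equal_head_partitions (2 * j + 2))"
    by (simp add: a_bar_def equal_head_partitions_def)
  ultimately show ?thesis
    using card_unequal_head[of j] card_equal_head[of j] assms by (simp add: PM_eq_card)
qed

end
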